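(* Let $\mathbb{F}$ be a field and let $n\ge 1$. Define the polynomial in the $3n$ variables $x_1,\dots,x_n,y_1,\dots,y_n,z_1,\dots,z_n$ \[ Q_n=\sum_{i=1}^n z_i\prod_{j=1}^n\bigl(x_j+y_{(j+i)\bmod n}\bigr), \] where indices of $y$ are taken modulo $n$ in $\{1,\dots,n\}$. If $A$ is a read-$k$ oblivious ABP of width $w$ computing $Q_n$, then $w\ge \exp\bigl(n/k^{O(k)}\bigr)$ (the constant in the $O(\cdot)$ being absolute).
   Context: An algebraic branching program (ABP) over $\mathbb{F}$ is a directed acyclic graph whose vertices are partitioned into layers $0,1,\dots,L$, with a single source in layer $0$ and a single sink in layer $L$, edges only from layer $\ell-1$ to layer $\ell$, each edge labeled by a polynomial; it computes the sum over all source–sink paths of the product of the edge labels on the path. Its width is the maximum number of vertices in a layer. It is oblivious if for every layer $\ell$ all edge labels in that layer are univariate polynomials in a single variable $x_{i_\ell}$ (the layer "reads" that variable). An oblivious ABP is read-$k$ if each variable is read in at most $k$ layers.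
   Formalization: The quantity k^{O(k)} is taken as max(k,2)^{Ck} with C absolute: for k = 1 the literal value 1 would give w ≥ e^n, which fails for n = 1, since z_1(x_1+y_1) has a read-once oblivious ABP of width 2; for k ≥ 2 nothing changes. *)

theory Defs
  imports Complex_Main "HOL-Library.Poly_Mapping"
begin

section \<open>Multivariate polynomials\<close>

text \<open>
  A monomial is a finitely supported exponent map \<open>'x \<Rightarrow>\<^sub>0 nat\<close>, a polynomial a finitely supported
  map from monomials to coefficients; \<open>*\<close> on \<open>poly_mapping\<close> is convolution, that is, polynomial
  multiplication. Equality of polynomials is formal, which matters over finite fields.
\<close>

type_synonym ('x, 'a) mpoly = "('x \<Rightarrow>\<^sub>0 nat) \<Rightarrow>\<^sub>0 'a"

definition mvar :: "'x \<Rightarrow> ('x, 'a::comm_semiring_1) mpoly" where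
  "mvar x = Poly_Mapping.single (Poly_Mapping.single x 1) 1"

definition mvars :: "('x, 'a::zero) mpoly \<Rightarrow> 'x set" where
  "mvars p = (\<Union>m \<in> Poly_Mapping.keys p. Poly_Mapping.keys m)"

definition univariate_in :: "'x \<Rightarrow> ('x, 'a::zero) mpoly \<Rightarrow> bool" where
  "univariate_in x p \<longleftrightarrow> mvars p \<subseteq> {x}"


section \<open>Algebraic branching programs\<close>

text \<open>
  \<open>'v\<close> is the type of vertices, \<open>'x\<close> the type of variables. The layers are \<open>layer A 0\<close>, ...,
  \<open>layer A (depth A)\<close>. The values of \<open>layer\<close> beyond the depth, and of \<open>label\<close> off the edges, are
  irrelevant.
\<close>

record (overloaded) ('v, 'x, 'a) abp =
  depth :: nat
  layer :: "nat \<Rightarrow> 'v set"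
  source :: 'v
  sink :: 'v
  edges :: "('v \<times> 'v) set"
  label :: "'v \<times> 'v \<Rightarrow> ('x \<Rightarrow>\<^sub>0 nat) \<Rightarrow>\<^sub>0 'a"

definition layer_edges :: "('v, 'x, 'a) abp \<Rightarrow> nat \<Rightarrow> ('v \<times> 'v) set" where
  "layer_edges A l = edges A \<inter> (layer A (l - 1) \<times> layer A l)"

text \<open>
  Acyclicity is not listed: it follows from the layering. Edge layers are numbered from \<open>1\<close> to
  \<open>depth A\<close>, edge layer \<open>l\<close> going from vertex layer \<open>l - 1\<close> to vertex layer \<open>l\<close>.
\<close>

definition abp :: "('v, 'x, 'a) abp \<Rightarrow> bool" where
  "abp A \<longleftrightarrow>
     (\<forall>l \<le> depth A. finite (layer A l)) \<and>
     (\<forall>l \<le> depth A. \<forall>m \<le> depth A. l \<noteq> m \<longrightarrow> layer A l \<inter> layer A m = {}) \<and>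
     layer A 0 = {source A} \<and>
     layer A (depth A) = {sink A} \<and>
     edges A = (\<Union>l \<in> {1..depth A}. layer_edges A l)"

definition abp_width :: "('v, 'x, 'a) abp \<Rightarrow> nat" where
  "abp_width A = Max ((\<lambda>l. card (layer A l)) ` {0..depth A})"

definition st_paths :: "('v, 'x, 'a) abp \<Rightarrow> 'v list set" where
  "st_paths A = {p. p \<noteq> [] \<and> hd p = source A \<and> last p = sink A \<and>
                    successively (\<lambda>u v. (u, v) \<in> edges A) p}"

definition path_edges :: "'v list \<Rightarrow> ('v \<times> 'v) list" where
  "path_edges p = zip p (tl p)"

text \<open>For an \<open>abp\<close> the set of paths is finite (\<open>finite_st_paths\<close> below), so the sum is a genuine one.\<close>

definition abp_poly :: "('v, 'x, 'a::comm_semiring_1) abp \<Rightarrow> ('x, 'a) mpoly" where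
  "abp_poly A = (\<Sum>p \<in> st_paths A. prod_list (map (label A) (path_edges p)))"

text \<open>\<open>\<rho> l\<close> is the variable read by edge layer \<open>l\<close>.\<close>

definition oblivious_reading :: "('v, 'x, 'a::zero) abp \<Rightarrow> (nat \<Rightarrow> 'x) \<Rightarrow> bool" where
  "oblivious_reading A \<rho> \<longleftrightarrow>
     (\<forall>l \<in> {1..depth A}. \<forall>e \<in> layer_edges A l. univariate_in (\<rho> l) (label A e))"

definition read_k_oblivious_abp :: "nat \<Rightarrow> ('v, 'x, 'a::zero) abp \<Rightarrow> bool" where
  "read_k_oblivious_abp k A \<longleftrightarrow>
     abp A \<and> (\<exists>\<rho>. oblivious_reading A \<rho> \<and> (\<forall>x. card {l \<in> {1..depth A}. \<rho> l = x} \<le> k))"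

lemma finite_st_paths:
  assumes A: "abp A"
  shows "finite (st_paths A)"
proof -
  define V where "V = (\<Union>l \<in> {0..depth A}. layer A l)"
  have finV: "finite V"
    using A by (auto simp: V_def abp_def)
  have step: "\<exists>l < depth A. u \<in> layer A l \<and> v \<in> layer A (Suc l)" if "(u, v) \<in> edges A" for u v
  proof -
    have "edges A = (\<Union>l \<in> {1..depth A}. layer_edges A l)"
      using A by (simp add: abp_def)
    with that obtain l where l: "l \<in> {1..depth A}" "(u, v) \<in> layer_edges A l"
      by blast
    then show ?thesis
      by (intro exI[of _ "l - 1"]) (auto simp: layer_edges_def)
  qed
  have *: "i < length p \<Longrightarrow> p ! i \<in> layer A i \<and> i \<le> depth A" if p: "p \<in> st_paths A" for p i
  proof (induction i)
    case 0
    with p A show ?case by (auto simp: st_paths_def abp_def hd_conv_nth)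
  next
    case (Suc i)
    from p Suc.prems have "(p ! i, p ! Suc i) \<in> edges A"
      by (auto simp: st_paths_def successively_conv_nth)
    then obtain l where l: "l < depth A" "p ! i \<in> layer A l" "p ! Suc i \<in> layer A (Suc l)"
      using step by blast
    have "p ! i \<in> layer A i" "i \<le> depth A"
      using Suc by auto
    then have "l = i"
      using A l(1,2) unfolding abp_def by (metis disjoint_iff less_imp_le)
    with l show ?case by simp
  qed
  have "st_paths A \<subseteq> {p. set p \<subseteq> V \<and> length p \<le> Suc (depth A)}"
  proof (rule subsetI, rule CollectI, rule conjI)
    fix p assume p: "p \<in> st_paths A"
    show "set p \<subseteq> V"
      using *[OF p] by (fastforce simp: V_def in_set_conv_nth)
    from p have "p \<noteq> []" by (simp add: st_paths_def)
    then show "length p \<le> Suc (depth A)"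
      using *[OF p, of "length p - 1"] by (cases p) auto
  qed
  then show ?thesis
    using finite_lists_length_le[OF finV] finite_subset by blast
qed


section \<open>The polynomial\<close>

datatype qvar = X nat | Y nat | Z nat

text \<open>\<open>(m - 1) mod n + 1\<close> is the representative of \<open>m \<ge> 1\<close> modulo \<open>n\<close> in \<open>{1..n}\<close>.\<close>

definition cyc :: "nat \<Rightarrow> nat \<Rightarrow> nat" where
  "cyc n m = (m - 1) mod n + 1"

definition Q :: "nat \<Rightarrow> (qvar, 'a::comm_semiring_1) mpoly" where
  "Q n = (\<Sum>i = 1..n. mvar (Z i) * (\<Prod>j = 1..n. mvar (X j) + mvar (Y (cyc n (j + i)))))"


section \<open>The quantity $k^{O(k)}$\<close>

text \<open>
  Rendering of \<open>k^O(k)\<close>. The literal \<open>k powr (C * k)\<close> is \<open>1\<close> at \<open>k = 1\<close> for every \<open>C\<close>, and the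
  bound would read \<open>w \<ge> exp n\<close>, which is false: \<open>z\<^sub>1 (x\<^sub>1 + y\<^sub>1)\<close> has a read-once program of width
  \<open>2\<close>. The base is therefore kept at least \<open>2\<close>; for \<open>k \<ge> 2\<close> this is literally \<open>k powr (C * k)\<close>.
\<close>

definition k_pow_Ok :: "real \<Rightarrow> nat \<Rightarrow> real" where
  "k_pow_Ok C k = real (max k 2) powr (C * real k)"

text \<open>
  The constant \<open>C\<close> must not depend on the field. In HOL the field is a type, which cannot be
  quantified below an \<open>\<exists>C\<close>, so a bare existential would allow a different \<open>C\<close> for every field.
  Absoluteness is expressed by a numerical bound on \<open>C\<close> that mentions no type; its value is not
  significant (\<open>k_pow_Ok\<close> is increasing in \<open>C\<close>, so any valid constant may be enlarged).
\<close>

definition C_max :: real where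
  "C_max = 100"

end

theory Submission
  imports Defs "HOL-Library.FuncSet"
begin

text \<open>
  Cut the layers into \<open>O(k\<^sup>2)\<close> blocks. By pigeonhole there are at most \<open>k\<close> blocks containing all
  reads of at least \<open>n / k\<^sup>O\<^sup>(\<^sup>k\<^sup>)\<close> of the \<open>x\<^sub>j\<close>, while at least half of the \<open>y\<^sub>j\<close> are never read there.
  Averaging over the \<open>n\<close> shifts gives an \<open>i\<close> and a large set \<open>G\<close> of indices \<open>j\<close> such that \<open>x\<^sub>j\<close> is
  read only inside, and \<open>y\<^sub>j\<^sub>+\<^sub>i\<close> only outside these blocks. As the program enters or leaves the blocks
  at most \<open>2 * k\<close> times, the matrix of its values, with rows indexed by values of the \<open>x\<^sub>j\<close> and
  columns by values of the \<open>y\<^sub>j\<^sub>+\<^sub>i\<close> for \<open>j \<in> G\<close>, has rank at most \<open>w ^ (2 * k)\<close>. For \<open>z\<^sub>i = 1\<close> and all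
  other \<open>z\<close> equal to \<open>0\<close> it contains an invertible diagonal matrix of size \<open>2 ^ card G\<close>.
\<close>


section \<open>Evaluation of polynomials\<close>

definition mon_eval :: "('x \<Rightarrow> 'a::comm_semiring_1) \<Rightarrow> ('x \<Rightarrow>\<^sub>0 nat) \<Rightarrow> 'a" where
  "mon_eval \<sigma> m = (\<Prod>x \<in> Poly_Mapping.keys m. \<sigma> x ^ Poly_Mapping.lookup m x)"

definition mpoly_eval :: "('x \<Rightarrow> 'a::comm_semiring_1) \<Rightarrow> ('x, 'a) mpoly \<Rightarrow> 'a" where
  "mpoly_eval \<sigma> p = (\<Sum>m \<in> Poly_Mapping.keys p. Poly_Mapping.lookup p m * mon_eval \<sigma> m)"

text \<open>Exponents off the keys are \<open>0\<close> and give factors \<open>1\<close>. The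
  larger index set \<open>K\<close> lets two monomials be written over the same variables.\<close>

lemma mon_eval_superset:
  assumes "finite K" "Poly_Mapping.keys m \<subseteq> K"
  shows "mon_eval \<sigma> m = (\<Prod>x \<in> K. \<sigma> x ^ Poly_Mapping.lookup m x)"
  unfolding mon_eval_def
  by (rule prod.mono_neutral_left) (use assms in \<open>auto simp: in_keys_iff\<close>)

lemma mpoly_eval_superset:
  assumes "finite K" "Poly_Mapping.keys p \<subseteq> K"
  shows "mpoly_eval \<sigma> p = (\<Sum>m \<in> K. Poly_Mapping.lookup p m * mon_eval \<sigma> m)"
  unfolding mpoly_eval_def
  by (rule sum.mono_neutral_left) (use assms in \<open>auto simp: in_keys_iff\<close>)

lemma mon_eval_add: "mon_eval \<sigma> (m + m') = mon_eval \<sigma> m * mon_eval \<sigma> m'"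
proof -
  let ?K = "Poly_Mapping.keys m \<union> Poly_Mapping.keys m'"
  have "mon_eval \<sigma> (m + m') = (\<Prod>x \<in> ?K. \<sigma> x ^ Poly_Mapping.lookup (m + m') x)"
    by (rule mon_eval_superset) (use Poly_Mapping.keys_add[of m m'] in auto)
  also have "\<dots> = mon_eval \<sigma> m * mon_eval \<sigma> m'"
    by (simp add: mon_eval_superset[of ?K] lookup_add power_add prod.distrib)
  finally show ?thesis .
qed

lemma mpoly_eval_0 [simp]: "mpoly_eval \<sigma> 0 = 0"
  by (simp add: mpoly_eval_def)

lemma mpoly_eval_add: "mpoly_eval \<sigma> (p + q) = mpoly_eval \<sigma> p + mpoly_eval \<sigma> q"
proof -
  let ?K = "Poly_Mapping.keys p \<union> Poly_Mapping.keys q"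
  have "mpoly_eval \<sigma> (p + q) = (\<Sum>m \<in> ?K. Poly_Mapping.lookup (p + q) m * mon_eval \<sigma> m)"
    by (rule mpoly_eval_superset) (use Poly_Mapping.keys_add[of p q] in auto)
  also have "\<dots> = mpoly_eval \<sigma> p + mpoly_eval \<sigma> q"
    by (simp add: mpoly_eval_superset[of ?K] lookup_add distrib_right sum.distrib)
  finally show ?thesis .
qed

lemma mpoly_eval_sum: "mpoly_eval \<sigma> (\<Sum>i\<in>I. f i) = (\<Sum>i\<in>I. mpoly_eval \<sigma> (f i))"
  by (induction I rule: infinite_finite_induct) (simp_all add: mpoly_eval_add)

lemma mpoly_eval_single: "mpoly_eval \<sigma> (Poly_Mapping.single m c) = c * mon_eval \<sigma> m"
  by (subst mpoly_eval_superset[of "{m}"]) auto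

lemma mpoly_eq_sum_single:
  "p = (\<Sum>m \<in> Poly_Mapping.keys p. Poly_Mapping.single m (Poly_Mapping.lookup p m))"
  by (rule poly_mapping_eqI)
     (auto simp: lookup_sum lookup_single when_def sum.delta in_keys_iff)

lemma mpoly_eval_mult: "mpoly_eval \<sigma> (p * q) = mpoly_eval \<sigma> p * mpoly_eval \<sigma> q"
proof -
  have "p * q = (\<Sum>m \<in> Poly_Mapping.keys p. \<Sum>m' \<in> Poly_Mapping.keys q.
      Poly_Mapping.single (m + m') (Poly_Mapping.lookup p m * Poly_Mapping.lookup q m'))"
    by (subst mpoly_eq_sum_single[of p], subst mpoly_eq_sum_single[of q])
       (simp add: sum_product mult_single)
  then have "mpoly_eval \<sigma> (p * q) = (\<Sum>m \<in> Poly_Mapping.keys p. \<Sum>m' \<in> Poly_Mapping.keys q.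
      Poly_Mapping.lookup p m * Poly_Mapping.lookup q m' * (mon_eval \<sigma> m * mon_eval \<sigma> m'))"
    by (simp only: mpoly_eval_sum mpoly_eval_single mon_eval_add)
  then show ?thesis
    by (simp add: mpoly_eval_def sum_product mult_ac)
qed

lemma mpoly_eval_1 [simp]: "mpoly_eval \<sigma> 1 = 1"
  using mpoly_eval_single[of \<sigma> 0 1] by (simp add: mon_eval_def)

lemma mpoly_eval_prod: "mpoly_eval \<sigma> (\<Prod>i\<in>I. f i) = (\<Prod>i\<in>I. mpoly_eval \<sigma> (f i))"
  by (induction I rule: infinite_finite_induct) (simp_all add: mpoly_eval_mult)

lemma mpoly_eval_prod_list: "mpoly_eval \<sigma> (prod_list ps) = prod_list (map (mpoly_eval \<sigma>) ps)"
  by (induction ps) (simp_all add: mpoly_eval_mult)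

lemma mpoly_eval_mvar [simp]: "mpoly_eval \<sigma> (mvar x) = \<sigma> x"
  by (simp add: mvar_def mpoly_eval_single mon_eval_def)

text \<open>For a label that is univariate in \<open>\<rho> l\<close>, only the value of this one
  variable matters.\<close>

lemma mpoly_eval_cong:
  assumes "\<And>x. x \<in> mvars p \<Longrightarrow> \<sigma> x = \<tau> x"
  shows "mpoly_eval \<sigma> p = mpoly_eval \<tau> p"
  unfolding mpoly_eval_def mon_eval_def
  by (intro sum.cong prod.cong arg_cong2[where f = "(*)"] refl)
     (use assms in \<open>force simp: mvars_def\<close>)


section \<open>Matrices factoring through a space of small dimension\<close>

text \<open>Over a field this says that the matrix \<open>F\<close> has rank at most
  \<open>d\<close>; as a factorization it makes sense for infinite index types too.\<close>

definition factors_through :: "nat \<Rightarrow> ('s \<Rightarrow> 't \<Rightarrow> 'a::comm_semiring_1) \<Rightarrow> bool" where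
  "factors_through d F \<longleftrightarrow> (\<exists>g h. \<forall>s t. F s t = (\<Sum>i<d. g s i * h i t))"

lemma factors_throughI:
  assumes "finite I" and F: "\<And>s t. F s t = (\<Sum>i\<in>I. g s i * h i t)"
  shows "factors_through (card I) F"
proof -
  from ex_bij_betw_nat_finite[OF \<open>finite I\<close>] obtain \<phi> where \<phi>: "bij_betw \<phi> {..<card I} I"
    by (auto simp: atLeast0LessThan)
  have "F s t = (\<Sum>i<card I. g s (\<phi> i) * h (\<phi> i) t)" for s t
    unfolding F by (rule sum.reindex_bij_betw[OF \<phi>, symmetric])
  then show ?thesis
    unfolding factors_through_def
    by (intro exI[of _ "\<lambda>s i. g s (\<phi> i)"] exI[of _ "\<lambda>i. h (\<phi> i)"]) simp
qed

lemma factors_through_mono: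
  assumes "factors_through d F" "d \<le> e"
  shows "factors_through e F"
proof -
  from assms(1) obtain g h where F: "\<And>s t. F s t = (\<Sum>i<d. g s i * h i t)"
    unfolding factors_through_def by blast
  have "F s t = (\<Sum>i<e. (if i < d then g s i else 0) * h i t)" for s t
    unfolding F by (rule sum.mono_neutral_cong_left) (use assms(2) in auto)
  then show ?thesis
    unfolding factors_through_def
    by (intro exI[of _ "\<lambda>s i. if i < d then g s i else 0"] exI[of _ h]) simp
qed

text \<open>Gaussian elimination: a pivot \<open>p\<close> with \<open>f p d \<noteq> 0\<close>
  clears coordinate \<open>d\<close> of the other vectors, to which the induction hypothesis
  applies.\<close>

lemma ex_linear_relation:
  fixes f :: "'s \<Rightarrow> nat \<Rightarrow> 'a::field"
  assumes "finite S" "d < card S"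
  shows "\<exists>c. (\<exists>s\<in>S. c s \<noteq> 0) \<and> (\<forall>i<d. (\<Sum>s\<in>S. c s * f s i) = 0)"
  using assms
proof (induction d arbitrary: S f)
  case 0
  then have "S \<noteq> {}" by auto
  then show ?case by (intro exI[of _ "\<lambda>_. 1"]) auto
next
  case (Suc d)
  show ?case
  proof (cases "\<forall>s\<in>S. f s d = 0")
    case True
    from Suc.IH[of S f] Suc.prems obtain c where
      "\<exists>s\<in>S. c s \<noteq> 0" "\<forall>i<d. (\<Sum>s\<in>S. c s * f s i) = 0" by auto
    with True show ?thesis
      by (intro exI[of _ c]) (auto simp: less_Suc_eq)
  next
    case False
    then obtain p where p: "p \<in> S" "f p d \<noteq> 0" by blast
    let ?S = "S - {p}" and ?r = "\<lambda>s. f s d / f p d"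
    have "d < card ?S" using Suc.prems p by simp
    with Suc.IH[of ?S "\<lambda>s i. f s i - ?r s * f p i"] Suc.prems obtain c where
      c: "\<exists>s\<in>?S. c s \<noteq> 0" and
      c0: "\<And>i. i < d \<Longrightarrow> (\<Sum>s\<in>?S. c s * (f s i - ?r s * f p i)) = 0" by auto
    \<comment> \<open>The coefficient of the pivot undoes the elimination: \<open>c'\<close>
      combines the original vectors to what \<open>c\<close> makes of the reduced ones.\<close>
    define c' where "c' = c(p := - (\<Sum>s\<in>?S. c s * ?r s))"
    have split: "(\<Sum>s\<in>S. c' s * f s i) = (\<Sum>s\<in>?S. c s * (f s i - ?r s * f p i))" for i
    proof -
      have "(\<Sum>s\<in>S. c' s * f s i) = c' p * f p i + (\<Sum>s\<in>?S. c' s * f s i)"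
        by (rule sum.remove) (use Suc.prems p in auto)
      also have "(\<Sum>s\<in>?S. c' s * f s i) = (\<Sum>s\<in>?S. c s * f s i)"
        by (rule sum.cong) (auto simp: c'_def)
      also have "c' p * f p i + \<dots> = (\<Sum>s\<in>?S. c s * (f s i - ?r s * f p i))"
        by (simp add: c'_def sum_distrib_left sum_subtractf right_diff_distrib mult_ac)
      finally show ?thesis .
    qed
    have "(\<Sum>s\<in>S. c' s * f s i) = 0" if "i < Suc d" for i
      using that c0 p unfolding split by (auto simp: less_Suc_eq)
    moreover have "\<exists>s\<in>S. c' s \<noteq> 0" using c by (auto simp: c'_def)
    ultimately show ?thesis by blast
  qed
qed

text \<open>More than \<open>d\<close> rows of the left factor satisfy a linear relation, and so do
  the rows of \<open>F\<close>. In a column \<open>t\<close> with \<open>c t \<noteq> 0\<close> only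
  the diagonal entry survives.\<close>

lemma card_le_if_factors_through_diagonal:
  fixes F :: "'s \<Rightarrow> 's \<Rightarrow> 'a::field"
  assumes "factors_through d F" "finite S"
    and diag: "\<And>s. s \<in> S \<Longrightarrow> F s s \<noteq> 0"
    and off: "\<And>s t. s \<in> S \<Longrightarrow> t \<in> S \<Longrightarrow> s \<noteq> t \<Longrightarrow> F s t = 0"
  shows "card S \<le> d"
proof (rule ccontr)
  assume "\<not> card S \<le> d"
  from assms(1) obtain g h where F: "\<And>s t. F s t = (\<Sum>i<d. g s i * h i t)"
    unfolding factors_through_def by blast
  from ex_linear_relation[of S d g] \<open>\<not> card S \<le> d\<close> \<open>finite S\<close> obtain c t where
    t: "t \<in> S" "c t \<noteq> 0" and c0: "\<forall>i<d. (\<Sum>s\<in>S. c s * g s i) = 0" by auto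
  have "c t * F t t = (\<Sum>s\<in>S. c s * F s t)"
    by (subst sum.remove[OF \<open>finite S\<close> t(1)]) (use off t in \<open>auto intro!: sum.neutral\<close>)
  also have "\<dots> = (\<Sum>i<d. (\<Sum>s\<in>S. c s * g s i) * h i t)"
    unfolding F sum_distrib_left sum_distrib_right by (subst sum.swap) (simp add: mult_ac)
  also have "\<dots> = 0" using c0 by simp
  finally show False using t diag by simp
qed

text \<open>The index \<open>v\<close> changes sides: inserting the identity matrix on
  \<open>V\<close> enlarges the inner index \<open>i\<close> to a pair \<open>(i, u)\<close>, which
  costs a factor \<open>w\<close>.\<close>

lemma factors_through_switch:
  assumes "factors_through d (\<lambda>s (t, v). P s t v)"
    and V: "finite V" "card V \<le> w" "\<And>s t v. v \<notin> V \<Longrightarrow> P s t v = 0"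
  shows "factors_through (d * w) (\<lambda>t (s, v). P s t v)"
proof -
  from assms(1) obtain g h where P: "\<And>s t v. P s t v = (\<Sum>i<d. g s i * h i (t, v))"
    unfolding factors_through_def by fastforce
  have "P s t v = (\<Sum>(i, u) \<in> {..<d} \<times> V. h i (t, u) * (g s i * (if u = v then 1 else 0)))"
    for s t v
  proof -
    have "(\<Sum>(i, u) \<in> {..<d} \<times> V. h i (t, u) * (g s i * (if u = v then 1 else 0))) =
        (\<Sum>i<d. \<Sum>u\<in>V. if u = v then g s i * h i (t, u) else 0)"
      by (subst sum.cartesian_product[symmetric]) (auto intro!: sum.cong simp: mult_ac)
    also have "\<dots> = (if v \<in> V then P s t v else 0)"
      using V(1) by (simp add: P)
    finally show ?thesis using V(3) by auto
  qed
  then have "factors_through (card ({..<d} \<times> V)) (\<lambda>t (s, v). P s t v)"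
    by (intro factors_throughI[where g = "\<lambda>t (i, u). h i (t, u)" and
          h = "\<lambda>(i, u) (s, v). g s i * (if u = v then 1 else 0)"])
       (use V(1) in \<open>auto simp: case_prod_unfold\<close>)
  then show ?thesis
    by (rule factors_through_mono) (use V in \<open>simp add: card_cartesian_product\<close>)
qed

text \<open>As \<open>M\<close> is free of \<open>s\<close> and \<open>v\<close> sits on the side of
  \<open>t\<close>, the new layer is absorbed into the right factor.\<close>

lemma factors_through_step:
  assumes "factors_through d (\<lambda>s (t, v). P s t v)"
    and P': "\<And>s t v. P' s t v = (\<Sum>u\<in>V. P s t u * M t u v)"
  shows "factors_through d (\<lambda>s (t, v). P' s t v)"
proof -
  from assms(1) obtain g h where P: "\<And>s t v. P s t v = (\<Sum>i<d. g s i * h i (t, v))"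
    unfolding factors_through_def by fastforce
  have "P' s t v = (\<Sum>i<d. g s i * (\<Sum>u\<in>V. h i (t, u) * M t u v))" for s t v
    unfolding P' P sum_distrib_left sum_distrib_right by (subst sum.swap) (simp add: mult_ac)
  then show ?thesis
    unfolding factors_through_def
    by (intro exI[of _ g] exI[of _ "\<lambda>i (t, v). \<Sum>u\<in>V. h i (t, u) * M t u v"]) auto
qed

lemma factors_through_transpose:
  assumes "factors_through d F"
  shows "factors_through d (\<lambda>t s. F s t)"
proof -
  from assms obtain g h where "\<And>s t. F s t = (\<Sum>i<d. g s i * h i t)"
    unfolding factors_through_def by blast
  then show ?thesis
    unfolding factors_through_def
    by (intro exI[of _ "\<lambda>t i. h i t"] exI[of _ "\<lambda>i s. g s i"]) (simp add: mult_ac)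
qed

lemma factors_through_reindex:
  assumes "factors_through d F"
  shows "factors_through d (\<lambda>s t. F s (\<phi> t))"
proof -
  from assms obtain g h where "\<And>s t. F s t = (\<Sum>i<d. g s i * h i t)"
    unfolding factors_through_def by blast
  then show ?thesis
    unfolding factors_through_def
    by (intro exI[of _ g] exI[of _ "\<lambda>i t. h i (\<phi> t)"]) simp
qed


section \<open>Programs as matrix products\<close>

text \<open>The weights \<open>c\<close> are kept apart from the labels of \<open>A\<close>, so that
  the labels can be evaluated at varying points.\<close>

fun path_sum :: "('v, 'x, 'b) abp \<Rightarrow> ('v \<times> 'v \<Rightarrow> 'a::comm_semiring_1) \<Rightarrow> nat \<Rightarrow> 'v \<Rightarrow> 'a" where
  "path_sum A c 0 v = (if v = source A then 1 else 0)"
| "path_sum A c (Suc l) v =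
     (\<Sum>u\<in>layer A l. path_sum A c l u * (if (u, v) \<in> layer_edges A (Suc l) then c (u, v) else 0))"

definition paths_to :: "('v, 'x, 'a) abp \<Rightarrow> 'v \<Rightarrow> 'v list set" where
  "paths_to A v = {p. p \<noteq> [] \<and> hd p = source A \<and> last p = v \<and>
                    successively (\<lambda>u v. (u, v) \<in> edges A) p}"

lemma layer_edges_iff:
  assumes A: "abp A" and "l < depth A" "v \<in> layer A (Suc l)"
  shows "(u, v) \<in> edges A \<longleftrightarrow> (u, v) \<in> layer_edges A (Suc l)"
proof
  assume "(u, v) \<in> edges A"
  with A obtain m where m: "m \<in> {1..depth A}" "(u, v) \<in> layer_edges A m"
    unfolding abp_def by blast
  then have "v \<in> layer A m" by (simp add: layer_edges_def)
  with A assms m have "m = Suc l"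
    unfolding abp_def by (metis Suc_leI atLeastAtMost_iff disjoint_iff)
  with m show "(u, v) \<in> layer_edges A (Suc l)" by simp
qed (simp add: layer_edges_def)

lemma no_edge_into_source:
  assumes A: "abp A"
  shows "(u, source A) \<notin> edges A"
proof
  assume "(u, source A) \<in> edges A"
  with A obtain m where m: "m \<in> {1..depth A}" "(u, source A) \<in> layer_edges A m"
    unfolding abp_def by blast
  then have "source A \<in> layer A m" "source A \<in> layer A 0"
    using A by (auto simp: layer_edges_def abp_def)
  with A m show False
    unfolding abp_def by (metis atLeastAtMost_iff disjoint_iff le0 not_one_le_zero)
qed

lemma paths_to_source:
  assumes "abp A"
  shows "paths_to A (source A) = {[source A]}"
proof -
  have "p = [source A]" if p: "p \<in> paths_to A (source A)" for p
  proof (cases p rule: rev_cases)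
    case Nil
    with p show ?thesis by (simp add: paths_to_def)
  next
    case (snoc q v)
    with p no_edge_into_source[OF assms] show ?thesis
      by (cases "q = []") (auto simp: paths_to_def successively_append_iff)
  qed
  then show ?thesis by (auto simp: paths_to_def)
qed

text \<open>Layers are disjoint, so every edge into \<open>v\<close> starts in layer
  \<open>l\<close>; cutting off the last vertex inverts the map on the right.\<close>

lemma paths_to_Suc:
  assumes A: "abp A" and l: "l < depth A" and v: "v \<in> layer A (Suc l)"
  shows "paths_to A v =
    (\<Union>u\<in>{u \<in> layer A l. (u, v) \<in> layer_edges A (Suc l)}. (\<lambda>p. p @ [v]) ` paths_to A u)"
    (is "_ = ?R")
proof (intro subset_antisym subsetI)
  fix p assume p: "p \<in> paths_to A v"
  have "source A \<in> layer A 0" using A by (simp add: abp_def)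
  with A l v have "v \<noteq> source A"
    unfolding abp_def by (metis Suc_leI disjoint_iff le0 nat.distinct(1))
  define q where "q = butlast p"
  with p have pq: "p = q @ [v]"
    by (auto simp: paths_to_def)
  with p \<open>v \<noteq> source A\<close> have "q \<noteq> []"
    by (auto simp: paths_to_def)
  note q = pq this
  with p have "(last q, v) \<in> edges A" "q \<in> paths_to A (last q)"
    by (auto simp: paths_to_def successively_append_iff)
  then show "p \<in> ?R"
    using q layer_edges_iff[OF A l v, of "last q"] by (force simp: layer_edges_def)
next
  fix p assume "p \<in> ?R"
  then show "p \<in> paths_to A v"
    using layer_edges_iff[OF A l v]
    by (auto simp: paths_to_def successively_append_iff)
qed

lemma finite_paths_to:
  assumes A: "abp A"
  shows "l \<le> depth A \<Longrightarrow> v \<in> layer A l \<Longrightarrow> finite (paths_to A v)"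
proof (induction l arbitrary: v)
  case 0
  with A paths_to_source[OF A] show ?case by (simp add: abp_def)
next
  case (Suc l)
  then show ?case
    using A by (subst paths_to_Suc[OF A, of l]) (auto simp: abp_def)
qed

lemma path_edges_snoc:
  "p \<noteq> [] \<Longrightarrow> path_edges (p @ [v]) = path_edges p @ [(last p, v)]"
  by (induction p rule: induct_list012) (auto simp: path_edges_def)

text \<open>Paths are grouped by their last vertex but one, and the weight of the last edge is
  factored out.\<close>

lemma path_sum_eq:
  assumes A: "abp A"
  shows "l \<le> depth A \<Longrightarrow> v \<in> layer A l \<Longrightarrow>
    path_sum A c l v = (\<Sum>p\<in>paths_to A v. prod_list (map c (path_edges p)))"
proof (induction l arbitrary: v)
  case 0
  with A have "v = source A" by (simp add: abp_def)
  then show ?case by (simp add: paths_to_source[OF A] path_edges_def)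
next
  case (Suc l)
  let ?U = "{u \<in> layer A l. (u, v) \<in> layer_edges A (Suc l)}"
  have fin: "finite (layer A l)" using A Suc.prems by (simp add: abp_def)
  have "(\<Sum>p\<in>paths_to A v. prod_list (map c (path_edges p))) =
      (\<Sum>u\<in>?U. \<Sum>p\<in>(\<lambda>p. p @ [v]) ` paths_to A u. prod_list (map c (path_edges p)))"
    unfolding paths_to_Suc[OF A Suc_le_lessD[OF Suc.prems(1)] Suc.prems(2)]
  proof (rule sum.UNION_disjoint)
    show "\<forall>u\<in>?U. finite ((\<lambda>p. p @ [v]) ` paths_to A u)"
      using finite_paths_to[OF A, of l] Suc.prems by auto
  qed (use fin in \<open>auto simp: paths_to_def\<close>)
  also have "\<dots> = (\<Sum>u\<in>?U. path_sum A c l u * c (u, v))"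
  proof (rule sum.cong[OF refl])
    fix u assume u: "u \<in> ?U"
    have "(\<Sum>p\<in>(\<lambda>p. p @ [v]) ` paths_to A u. prod_list (map c (path_edges p))) =
        (\<Sum>p\<in>paths_to A u. prod_list (map c (path_edges p)) * c (u, v))"
      by (subst sum.reindex) (auto simp: inj_on_def paths_to_def path_edges_snoc intro!: sum.cong)
    also have "\<dots> = path_sum A c l u * c (u, v)"
      using u Suc by (simp add: sum_distrib_right)
    finally show "(\<Sum>p\<in>(\<lambda>p. p @ [v]) ` paths_to A u. prod_list (map c (path_edges p))) =
        path_sum A c l u * c (u, v)" .
  qed
  also have "\<dots> = path_sum A c (Suc l) v"
    using fin by (auto simp: sum.inter_filter intro!: sum.cong)
  finally show ?case by simp
qed

lemma mpoly_eval_abp_poly: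
  assumes "abp A"
  shows "mpoly_eval \<sigma> (abp_poly A) = path_sum A (mpoly_eval \<sigma> \<circ> label A) (depth A) (sink A)"
proof -
  have "sink A \<in> layer A (depth A)" using assms by (simp add: abp_def)
  from path_sum_eq[OF assms order.refl this, of "mpoly_eval \<sigma> \<circ> label A"] show ?thesis
    by (simp add: abp_poly_def st_paths_def paths_to_def mpoly_eval_sum mpoly_eval_prod_list)
qed

lemma path_sum_eq_0:
  assumes "abp A" "v \<notin> layer A l"
  shows "path_sum A c l v = 0"
  using assms by (cases l) (auto simp: abp_def layer_edges_def)

lemma card_layer_le_width:
  assumes "l \<le> depth A"
  shows "card (layer A l) \<le> abp_width A"
  unfolding abp_width_def using assms by (intro Max_ge) auto

text \<open>Edge layers are numbered from \<open>1\<close>, so the first one has no predecessor and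
  the range starts at \<open>2\<close>.\<close>

definition switches :: "(nat \<Rightarrow> bool) \<Rightarrow> nat \<Rightarrow> nat set" where
  "switches \<chi> l = {m \<in> {2..l}. \<chi> m \<noteq> \<chi> (m - 1)}"

text \<open>
  The vertex index \<open>v\<close> is kept on the side (\<open>s\<close> or \<open>t\<close>) that the last edge layer depends on. A further
  layer of the same kind then acts on one factor only, and just a switch costs a factor \<open>w\<close>.
\<close>

lemma path_sum_factors_through:
  fixes \<sigma> :: "'s \<Rightarrow> 's \<Rightarrow> 'x \<Rightarrow> 'a::field"
  assumes A: "abp A" and w: "abp_width A \<le> w"
    and T: "\<And>l s s' t e. 1 \<le> l \<Longrightarrow> l \<le> depth A \<Longrightarrow> \<not> \<chi> l \<Longrightarrow> e \<in> layer_edges A l \<Longrightarrow>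
      mpoly_eval (\<sigma> s t) (label A e) = mpoly_eval (\<sigma> s' t) (label A e)"
    and S: "\<And>l s t t' e. 1 \<le> l \<Longrightarrow> l \<le> depth A \<Longrightarrow> \<chi> l \<Longrightarrow> e \<in> layer_edges A l \<Longrightarrow>
      mpoly_eval (\<sigma> s t) (label A e) = mpoly_eval (\<sigma> s t') (label A e)"
  defines "P \<equiv> \<lambda>l s t. path_sum A (mpoly_eval (\<sigma> s t) \<circ> label A) l"
  shows "1 \<le> l \<Longrightarrow> l \<le> depth A \<Longrightarrow>
    (if \<chi> l then factors_through (w ^ card (switches \<chi> l)) (\<lambda>t (s, v). P l s t v)
     else factors_through (w ^ card (switches \<chi> l)) (\<lambda>s (t, v). P l s t v))"
proof (induction l)
  case (Suc l)
  define d where "d = w ^ card (switches \<chi> (Suc l))"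
  have prev: "if \<chi> (Suc l) then factors_through d (\<lambda>t (s, v). P l s t v)
      else factors_through d (\<lambda>s (t, v). P l s t v)"
  proof (cases "l = 0")
    case True
    \<comment> \<open>Before the first layer there is only the indicator of the source. It depends
      on neither \<open>s\<close> nor \<open>t\<close>, so one summand suffices for either kind of
      first layer.\<close>
    have 1: "factors_through (card {()}) (\<lambda>(s::'s) (t::'s, v). if v = source A then 1 else 0 :: 'a)"
      by (rule factors_throughI[where g = "\<lambda>_ _. 1" and
          h = "\<lambda>_ (_, v). if v = source A then 1 else 0"]) auto
    with True show ?thesis by (simp add: P_def d_def switches_def)
  next
    case False
    have fin: "finite (layer A l)" and card: "card (layer A l) \<le> w"
      using A Suc.prems w card_layer_le_width[of l A] by (auto simp: abp_def)
    have out: "P l s t v = 0" if "v \<notin> layer A l" for s t v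
      using path_sum_eq_0[OF A that] by (simp add: P_def)
    from False Suc have IH: "if \<chi> l
        then factors_through (w ^ card (switches \<chi> l)) (\<lambda>t (s, v). P l s t v)
        else factors_through (w ^ card (switches \<chi> l)) (\<lambda>s (t, v). P l s t v)"
      by simp
    show ?thesis
    proof (cases "\<chi> (Suc l) = \<chi> l")
      case True
      then have "switches \<chi> (Suc l) = switches \<chi> l"
        using False by (auto simp: switches_def le_Suc_eq)
      with IH True show ?thesis by (simp add: d_def)
    next
      case neq: False
      then have "switches \<chi> (Suc l) = insert (Suc l) (switches \<chi> l)"
        using False by (auto simp: switches_def le_Suc_eq)
      then have d: "d = w ^ card (switches \<chi> l) * w"
        by (simp add: d_def switches_def)
      show ?thesis
        using IH neq factors_through_switch[OF _ fin card, of _ "\<lambda>s t. P l s t"]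
          factors_through_switch[OF _ fin card, of _ "\<lambda>t s. P l s t"] out
        by (auto simp: d split: if_splits)
    qed
  qed
  define M where "M s t u v = (if (u, v) \<in> layer_edges A (Suc l)
      then mpoly_eval (\<sigma> s t) (label A (u, v)) else 0)" for s t u v
  have step: "P (Suc l) s t v = (\<Sum>u\<in>layer A l. P l s t u * M s t u v)" for s t v
    by (simp add: P_def M_def comp_def)
  show ?case
  proof (cases "\<chi> (Suc l)")
    case True
    \<comment> \<open>By \<open>S\<close> this matrix does not depend on \<open>t\<close>, so any
      fixed value may stand there.\<close>
    have indep: "M s t u v = M s undefined u v" for s t u v
      unfolding M_def using S[OF _ Suc.prems(2) True] by auto
    then have "P (Suc l) s t v = (\<Sum>u\<in>layer A l. P l s t u * M s undefined u v)" for s t v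
      by (simp only: step indep[of s t])
    from factors_through_step[of d "\<lambda>t s. P l s t" "\<lambda>t s. P (Suc l) s t", OF _ this]
    show ?thesis using prev True by (simp add: d_def)
  next
    case False
    have indep: "M s t u v = M undefined t u v" for s t u v
      unfolding M_def using T[OF _ Suc.prems(2) False] by auto
    then have "P (Suc l) s t v = (\<Sum>u\<in>layer A l. P l s t u * M undefined t u v)" for s t v
      by (simp only: step indep[of s t])
    from factors_through_step[of d "\<lambda>s t. P l s t" "\<lambda>s t. P (Suc l) s t", OF _ this]
    show ?thesis using prev False by (simp add: d_def)
  qed
qed simp

text \<open>The index \<open>v\<close> is fixed to the sink, with a transposition if the last layer
  satisfies \<open>\<chi>\<close>. At depth \<open>0\<close> there is no last layer, and the value
  is constant.\<close>

lemma mpoly_eval_abp_poly_factors_through: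
  fixes \<sigma> :: "'s \<Rightarrow> 's \<Rightarrow> 'x \<Rightarrow> 'a::field"
  assumes A: "abp A" and w: "abp_width A \<le> w"
    and T: "\<And>l s s' t e. 1 \<le> l \<Longrightarrow> l \<le> depth A \<Longrightarrow> \<not> \<chi> l \<Longrightarrow> e \<in> layer_edges A l \<Longrightarrow>
      mpoly_eval (\<sigma> s t) (label A e) = mpoly_eval (\<sigma> s' t) (label A e)"
    and S: "\<And>l s t t' e. 1 \<le> l \<Longrightarrow> l \<le> depth A \<Longrightarrow> \<chi> l \<Longrightarrow> e \<in> layer_edges A l \<Longrightarrow>
      mpoly_eval (\<sigma> s t) (label A e) = mpoly_eval (\<sigma> s t') (label A e)"
  shows "factors_through (w ^ card (switches \<chi> (depth A))) (\<lambda>s t. mpoly_eval (\<sigma> s t) (abp_poly A))"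
proof (cases "depth A = 0")
  case True
  have "factors_through (card {()}) (\<lambda>s t. mpoly_eval (\<sigma> s t) (abp_poly A))"
    using True A
    by (intro factors_throughI[where g = "\<lambda>_ _. 1" and h = "\<lambda>_ _. 1"])
       (auto simp: mpoly_eval_abp_poly[OF A] abp_def)
  with True show ?thesis by (simp add: switches_def)
next
  case False
  let ?P = "\<lambda>s t. path_sum A (mpoly_eval (\<sigma> s t) \<circ> label A) (depth A)"
  let ?d = "w ^ card (switches \<chi> (depth A))"
  have "if \<chi> (depth A) then factors_through ?d (\<lambda>t (s, v). ?P s t v)
      else factors_through ?d (\<lambda>s (t, v). ?P s t v)"
    using False by (intro path_sum_factors_through[OF A w T S]) auto
  then show ?thesis
    unfolding mpoly_eval_abp_poly[OF A]
    using factors_through_reindex[of ?d "\<lambda>s (t, v). ?P s t v" "\<lambda>t. (t, sink A)"]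
      factors_through_transpose[OF factors_through_reindex[of ?d "\<lambda>t (s, v). ?P s t v" "\<lambda>s. (s, sink A)"]]
    by (auto split: if_splits)
qed


section \<open>The rank of the hard polynomial\<close>

lemma cyc_in: "1 \<le> n \<Longrightarrow> cyc n m \<in> {1..n}"
  by (simp add: cyc_def Suc_leI)

lemma inj_on_cyc: "inj_on (\<lambda>j. cyc n (j + i)) {1..n}"
proof (rule linorder_inj_onI)
  fix a b assume ab: "a < b" "a \<in> {1..n}" "b \<in> {1..n}"
  show "cyc n (a + i) \<noteq> cyc n (b + i)"
  proof
    assume "cyc n (a + i) = cyc n (b + i)"
    then have "(b + i - 1) mod n = (a + i - 1) mod n" by (simp add: cyc_def)
    then have "n dvd (b + i - 1) - (a + i - 1)"
      using ab by (subst mod_eq_dvd_iff_nat[symmetric]) auto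
    then have "n dvd b - a" using ab by simp
    with ab show False by (auto dest: dvd_imp_le)
  qed
qed auto

lemma mpoly_eval_Q:
  assumes "i \<in> {1..n}" and Z: "\<And>m. \<sigma> (Z m) = (if m = i then 1 else 0)"
  shows "mpoly_eval \<sigma> (Q n) = (\<Prod>j=1..n. \<sigma> (X j) + \<sigma> (Y (cyc n (j + i))))"
proof -
  have "mpoly_eval \<sigma> (Q n) =
      (\<Sum>m=1..n. if m = i then \<Prod>j=1..n. \<sigma> (X j) + \<sigma> (Y (cyc n (j + m))) else 0)"
    unfolding Q_def mpoly_eval_sum
    by (rule sum.cong) (simp_all add: mpoly_eval_mult mpoly_eval_prod mpoly_eval_add Z)
  then show ?thesis using assms(1) by simp
qed

text \<open>
  On the points below the factor \<open>x\<^sub>j + y\<^sub>j\<^sub>+\<^sub>i\<close> with \<open>j \<in> G\<close> vanishes iff \<open>j\<close> lies in exactly one of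
  \<open>S\<close> and \<open>T\<close>, and is \<open>1\<close> or \<open>-1\<close> otherwise; so \<open>Q\<close> becomes an invertible diagonal matrix in
  \<open>(S, T)\<close>, over every field.
\<close>

fun test_point :: "nat \<Rightarrow> nat \<Rightarrow> nat set \<Rightarrow> nat set \<Rightarrow> nat set \<Rightarrow> qvar \<Rightarrow> 'a::field" where
  "test_point n i G S T (X j) = (if j \<in> G \<longrightarrow> j \<in> S then 1 else 0)"
| "test_point n i G S T (Y m) = (if \<exists>j\<in>G. m = cyc n (j + i) \<and> j \<notin> T then -1 else 0)"
| "test_point n i G S T (Z m) = (if m = i then 1 else 0)"

lemma test_point_Q:
  assumes i: "i \<in> {1..n}" and G: "G \<subseteq> {1..n}" and ST: "S \<subseteq> G" "T \<subseteq> G"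
  shows "(mpoly_eval (test_point n i G S T) (Q n) :: 'a::field) = 0 \<longleftrightarrow> S \<noteq> T"
proof -
  \<comment> \<open>The shift is injective, so the \<open>j'\<close> that decides the value at
    \<open>Y\<close> is \<open>j\<close> itself.\<close>
  have Y: "(\<exists>j'\<in>G. cyc n (j + i) = cyc n (j' + i) \<and> j' \<notin> T) \<longleftrightarrow> j \<in> G \<and> j \<notin> T"
    if "j \<in> {1..n}" for j
    using that G inj_onD[OF inj_on_cyc[of n i]] by blast
  have "(mpoly_eval (test_point n i G S T) (Q n) :: 'a) = 0 \<longleftrightarrow>
      (\<exists>j\<in>{1..n}. (if j \<in> G \<longrightarrow> j \<in> S then 1 else 0) + (if j \<in> G \<and> j \<notin> T then -1 else 0) = (0::'a))"
    using i by (simp add: mpoly_eval_Q prod_zero_iff Y cong: bex_cong del: atLeastAtMost_iff)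
  also have "\<dots> \<longleftrightarrow> S \<noteq> T"
    using G ST by auto
  finally show ?thesis .
qed

text \<open>The diagonal matrix is indexed by \<open>Pow G\<close>. Only the \<open>X j\<close> with
  \<open>j \<in> G\<close> depend on the row and only their partners
  \<open>Y (cyc n (j + i))\<close> on the column, so \<open>\<chi>\<close> tells which side a layer
  may depend on.\<close>

lemma two_power_le_width_power:
  fixes A :: "('v, qvar, 'a::field) abp"
  assumes A: "abp A" and w: "abp_width A \<le> w" and \<rho>: "oblivious_reading A \<rho>"
    and Q: "abp_poly A = Q n" and G: "G \<subseteq> {1..n}" and i: "i \<in> {1..n}"
    and X: "\<And>l j. l \<in> {1..depth A} \<Longrightarrow> j \<in> G \<Longrightarrow> \<rho> l = X j \<Longrightarrow> \<chi> l"
    and Y: "\<And>l j. l \<in> {1..depth A} \<Longrightarrow> j \<in> G \<Longrightarrow> \<rho> l = Y (cyc n (j + i)) \<Longrightarrow> \<not> \<chi> l"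
  shows "2 ^ card G \<le> w ^ card (switches \<chi> (depth A))"
proof -
  let ?\<sigma> = "test_point n i G :: _ \<Rightarrow> _ \<Rightarrow> _ \<Rightarrow> 'a"
  have univ: "mvars (label A e) \<subseteq> {\<rho> l}" if "1 \<le> l" "l \<le> depth A" "e \<in> layer_edges A l" for l e
    using that \<rho> by (auto simp: oblivious_reading_def univariate_in_def)
  have "factors_through (w ^ card (switches \<chi> (depth A))) (\<lambda>S T. mpoly_eval (?\<sigma> S T) (abp_poly A))"
  proof (rule mpoly_eval_abp_poly_factors_through[OF A w])
    fix l S S' T e
    assume l: "1 \<le> l" "l \<le> depth A" "\<not> \<chi> l" "e \<in> layer_edges A l"
    then have "?\<sigma> S T (\<rho> l) = ?\<sigma> S' T (\<rho> l)"
      using X[of l] by (cases "\<rho> l") auto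
    with univ[OF l(1,2,4)] show "mpoly_eval (?\<sigma> S T) (label A e) = mpoly_eval (?\<sigma> S' T) (label A e)"
      by (intro mpoly_eval_cong) auto
  next
    fix l S T T' e
    assume l: "1 \<le> l" "l \<le> depth A" "\<chi> l" "e \<in> layer_edges A l"
    then have "?\<sigma> S T (\<rho> l) = ?\<sigma> S T' (\<rho> l)"
      using Y[of l] by (cases "\<rho> l") auto
    with univ[OF l(1,2,4)] show "mpoly_eval (?\<sigma> S T) (label A e) = mpoly_eval (?\<sigma> S T') (label A e)"
      by (intro mpoly_eval_cong) auto
  qed
  then have "card (Pow G) \<le> w ^ card (switches \<chi> (depth A))"
    by (rule card_le_if_factors_through_diagonal)
       (use finite_subset[OF G] in \<open>simp_all add: Q test_point_Q[OF i G]\<close>)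
  then show ?thesis
    using finite_subset[OF G] by (simp add: card_Pow)
qed


section \<open>Separating the reads of many variables\<close>

text \<open>For monotone \<open>b\<close> every block is an interval of layers, entered and left at
  most once. Each switch enters or leaves a block of \<open>J\<close>.\<close>

lemma card_switches_le:
  assumes "mono b" "finite J"
  shows "card (switches (\<lambda>l. b l \<in> J) L) \<le> 2 * card J"
proof -
  let ?S = "switches (\<lambda>l. b l \<in> J) L"
  define In where "In = {m \<in> ?S. b m \<in> J}"
  define Out where "Out = {m \<in> ?S. b (m - 1) \<in> J}"
  have le: "b m \<le> b (m' - 1)" "b (m - 1) \<le> b m" if "m < m'" for m m'
    using that by (auto intro!: monoD[OF assms(1)])
  have "card In \<le> card J"
  proof (rule card_inj_on_le[OF _ _ assms(2)])
    show "inj_on b In"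
    proof (rule linorder_inj_onI)
      fix m m' assume m: "m < m'" "m \<in> In" "m' \<in> In"
      show "b m \<noteq> b m'"
      proof
        assume "b m = b m'"
        \<comment> \<open>Monotonicity squeezes \<open>b (m' - 1)\<close> between \<open>b m\<close>
          and \<open>b m'\<close>, so \<open>m'\<close> would not be a switch.\<close>
        with le(1)[OF m(1)] le(2)[of m' "Suc m'"] have "b (m' - 1) = b m" by auto
        with m show False by (auto simp: In_def switches_def)
      qed
    qed auto
  qed (auto simp: In_def)
  moreover have "card Out \<le> card J"
  proof (rule card_inj_on_le[OF _ _ assms(2)])
    show "inj_on (\<lambda>m. b (m - 1)) Out"
    proof (rule linorder_inj_onI)
      fix m m' assume m: "m < m'" "m \<in> Out" "m' \<in> Out"
      show "b (m - 1) \<noteq> b (m' - 1)"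
      proof
        assume "b (m - 1) = b (m' - 1)"
        with le[OF m(1)] have "b m = b (m - 1)" by auto
        with m show False by (auto simp: Out_def switches_def)
      qed
    qed auto
  qed (auto simp: Out_def)
  moreover have "card ?S \<le> card (In \<union> Out)"
    by (rule card_mono) (auto simp: In_def Out_def switches_def)
  ultimately show ?thesis
    using card_Un_le[of In Out] by linarith
qed

text \<open>A set is the range of a list of length \<open>k\<close>, where the spare element \<open>R\<close> serves as padding.\<close>

lemma card_small_subsets_le:
  "card {J. J \<subseteq> {..<R::nat} \<and> card J \<le> k} \<le> (R + 1) ^ k"
proof -
  let ?L = "{xs. set xs \<subseteq> {..R} \<and> length xs = k}"
  have "{J. J \<subseteq> {..<R} \<and> card J \<le> k} \<subseteq> (\<lambda>xs. set xs - {R}) ` ?L"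
  proof
    fix J assume "J \<in> {J. J \<subseteq> {..<R} \<and> card J \<le> k}"
    then have J: "J \<subseteq> {..<R}" "card J \<le> k" "finite J" by (auto intro: finite_subset)
    then obtain xs where "set xs = J" "length xs = card J"
      using finite_distinct_list distinct_card by metis
    with J show "J \<in> (\<lambda>xs. set xs - {R}) ` ?L"
      by (intro image_eqI[of _ _ "xs @ replicate (k - card J) R"]) auto
  qed
  moreover have "finite ?L" by (rule finite_lists_length_eq) simp
  ultimately have "card {J. J \<subseteq> {..<R} \<and> card J \<le> k} \<le> card ?L"
    by (rule surj_card_le[rotated])
  then show ?thesis by (simp add: card_lists_length_eq)
qed

text \<open>
  Averaging over \<open>i\<close>: for a fixed \<open>j\<close>, at most half of the shifts hit the set \<open>B\<close>.
\<close>

lemma ex_shift_avoiding: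
  assumes n: "1 \<le> n" and U: "U \<subseteq> {1..n}" and B: "B \<subseteq> {1..n}" "2 * card B \<le> n"
  shows "\<exists>i\<in>{1..n}. card U \<le> 2 * card {j \<in> U. cyc n (j + i) \<notin> B}"
proof (rule ccontr)
  assume "\<not> ?thesis"
  then have less: "2 * card {j \<in> U. cyc n (j + i) \<notin> B} < card U" if "i \<in> {1..n}" for i
    using that by (meson not_le)
  have finU: "finite U" using U finite_subset by blast
  have col: "n \<le> 2 * card {i \<in> {1..n}. cyc n (j + i) \<notin> B}" for j
  proof -
    let ?H = "{i \<in> {1..n}. cyc n (j + i) \<in> B}"
    have "inj_on (\<lambda>i. cyc n (j + i)) ?H"
      using inj_on_cyc[of n j] by (auto simp: add.commute intro: inj_on_subset)
    then have "card ?H \<le> card B"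
      by (rule card_inj_on_le) (use B(1) in \<open>auto intro: finite_subset\<close>)
    moreover have "card ({1..n} - ?H) = n - card ?H"
      by (subst card_Diff_subset) auto
    moreover have "{i \<in> {1..n}. cyc n (j + i) \<notin> B} = {1..n} - ?H" by auto
    ultimately show ?thesis using B(2) by presburger
  qed
  \<comment> \<open>Double counting of the pairs \<open>(j, i)\<close> whose shifted index lies
    outside \<open>B\<close>.\<close>
  have "card U * n \<le> (\<Sum>j\<in>U. 2 * card {i \<in> {1..n}. cyc n (j + i) \<notin> B})"
    using sum_mono[of U "\<lambda>_. n", OF col] by simp
  also have "\<dots> = (\<Sum>i\<in>{1..n}. 2 * card {j \<in> U. cyc n (j + i) \<notin> B})"
    unfolding sum_distrib_left[symmetric]
    by (intro arg_cong[of _ _ "(*) 2"] sum_multicount_gen finU) auto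
  also have "\<dots> < (\<Sum>i\<in>{1..n}. card U)"
    by (rule sum_strict_mono) (use n less in auto)
  finally show False by simp
qed

text \<open>
  The layers are cut into blocks, each containing \<open>s = n div (2 * k)\<close> layers that read some \<open>y\<close>.
  A popular set \<open>J\<close> of blocks contains all reads of many \<open>x\<^sub>j\<close>; it has at most \<open>k\<close> blocks, so it
  touches at most half of the \<open>y\<close>.
\<close>

lemma ex_separation:
  assumes k: "1 \<le> k" and n: "2 * k \<le> n"
    and reads: "\<And>x. card {l \<in> {1..L}. \<rho> l = x} \<le> k"
  shows "\<exists>G i \<chi>. G \<subseteq> {1..n} \<and> i \<in> {1..n} \<and> n \<le> 2 * card G * (4 * k\<^sup>2 + 1) ^ k \<and>
    card (switches \<chi> L) \<le> 2 * k \<and>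
    (\<forall>l\<in>{1..L}. \<forall>j\<in>G. (\<rho> l = X j \<longrightarrow> \<chi> l) \<and> (\<rho> l = Y (cyc n (j + i)) \<longrightarrow> \<not> \<chi> l))"
proof -
  \<comment> \<open>This size balances two needs: \<open>k\<close> blocks hold at most
    \<open>n / 2\<close> of the layers reading some \<open>y\<close>, as
    \<open>2 * (k * s) \<le> n\<close>, while \<open>n < 4 * k * s\<close> keeps the number of
    blocks within \<open>4 * k\<^sup>2\<close>.\<close>
  define s where "s = n div (2 * k)"
  have "n < 2 * k * s + 2 * k"
    using k dividend_less_times_div[of "2 * k" n] by (simp add: s_def add.commute)
  moreover have s1: "1 \<le> s" and ks: "2 * (k * s) \<le> n"
    using n k by (simp_all add: s_def div_greater_zero_iff Suc_le_eq mult.assoc[symmetric])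
  ultimately have ns: "n < 4 * k * s"
    using mult_le_mono2[OF s1, of "2 * k"] by linarith
  define YR where "YR = {l \<in> {1..L}. \<exists>j\<in>{1..n}. \<rho> l = Y j}"
  have fYR: "finite YR" by (simp add: YR_def)
  \<comment> \<open>Counting the preceding \<open>y\<close>-reads assigns every layer to a block,
    including those that read no \<open>y\<close>.\<close>
  define cnt where "cnt l = card {m \<in> YR. m < l}" for l
  define b where "b l = cnt l div s" for l
  define R where "R = 4 * k\<^sup>2"
  have cnt_mono: "mono cnt"
    unfolding cnt_def by (intro monoI card_mono) (use fYR in auto)
  then have b_mono: "mono b"
    unfolding b_def mono_def by (simp add: div_le_mono)
  have cnt_strict: "cnt l < cnt l'" if "l \<in> YR" "l < l'" for l l'
    unfolding cnt_def by (rule psubset_card_mono) (use fYR that in auto)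
  have "YR = (\<Union>j\<in>{1..n}. {l \<in> {1..L}. \<rho> l = Y j})" by (auto simp: YR_def)
  then have "card YR \<le> (\<Sum>j\<in>{1..n}. card {l \<in> {1..L}. \<rho> l = Y j})"
    by (simp only: card_UN_le[OF finite_atLeastAtMost])
  also have "\<dots> \<le> n * k"
    using sum_bounded_above[of "{1..n}" "\<lambda>j. card {l \<in> {1..L}. \<rho> l = Y j}" k] reads by simp
  finally have "card YR \<le> n * k" .
  moreover have "cnt l \<le> card YR" for l
    unfolding cnt_def by (rule card_mono) (use fYR in auto)
  moreover have "n * k < R * s"
    using mult_strict_right_mono[OF ns, of k] k by (simp add: R_def power2_eq_square mult_ac)
  ultimately have "cnt l < R * s" for l
    using le_less_trans order.trans by metis
  then have bR: "b l < R" for l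
    unfolding b_def using s1 by (simp add: div_less_iff_less_mult)

  \<comment> \<open>At most \<open>k\<close> layers read \<open>X j\<close>, so
    \<open>blocks j\<close> is one of at most \<open>(R + 1) ^ k\<close> sets; \<open>J\<close> is
    one attained often, and \<open>U\<close> collects its indices.\<close>
  define blocks where "blocks j = b ` {l \<in> {1..L}. \<rho> l = X j}" for j
  let ?B = "{J. J \<subseteq> {..<R} \<and> card J \<le> k}"
  have "blocks \<in> {1..n} \<rightarrow> ?B"
    using bR order.trans[OF card_image_le reads] by (auto simp: blocks_def simp del: atLeastAtMost_iff)
  moreover have "finite ?B" "?B \<noteq> {}" by (auto intro: finite_subset[of _ "Pow {..<R}"])
  ultimately obtain J where J: "J \<subseteq> {..<R}" "card J \<le> k"
    and popular: "n \<le> card (blocks -` {J} \<inter> {1..n}) * card ?B"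
    using pigeonhole_card[of blocks "{1..n}" ?B] by auto
  have finJ: "finite J" using J finite_subset by blast
  define U where "U = blocks -` {J} \<inter> {1..n}"
  have nU: "n \<le> card U * (R + 1) ^ k"
    using popular mult_le_mono2[OF card_small_subsets_le, of "card U" R k]
    unfolding U_def by (rule order.trans)

  define Bad where "Bad = {j \<in> {1..n}. \<exists>l\<in>{1..L}. \<rho> l = Y j \<and> b l \<in> J}"
  have block: "card {l \<in> YR. b l = c} \<le> s" for c
  proof -
    have "inj_on cnt {l \<in> YR. b l = c}"
      by (rule linorder_inj_onI) (use cnt_strict in fastforce)+
    moreover have "cnt ` {l \<in> YR. b l = c} \<subseteq> {c * s..<c * s + s}"
      using s1 by (auto simp: b_def dividend_less_div_times add.commute)
    ultimately have "card {l \<in> YR. b l = c} \<le> card {c * s..<c * s + s}"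
      by (intro card_inj_on_le) auto
    then show ?thesis by simp
  qed
  \<comment> \<open>A layer reads one variable only, so distinct bad indices need distinct layers;
    \<open>THE\<close> recovers the index from the layer.\<close>
  have "Bad \<subseteq> (\<lambda>l. THE j. \<rho> l = Y j) ` (\<Union>c\<in>J. {l \<in> YR. b l = c})"
  proof
    fix j assume "j \<in> Bad"
    then obtain l where "l \<in> YR" "\<rho> l = Y j" "b l \<in> J"
      by (auto simp: Bad_def YR_def)
    then show "j \<in> (\<lambda>l. THE j. \<rho> l = Y j) ` (\<Union>c\<in>J. {l \<in> YR. b l = c})"
      by (intro image_eqI[of _ _ l]) auto
  qed
  then have "card Bad \<le> card (\<Union>c\<in>J. {l \<in> YR. b l = c})"
    by (rule surj_card_le[rotated]) (use finJ fYR in auto)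
  also have "\<dots> \<le> (\<Sum>c\<in>J. card {l \<in> YR. b l = c})"
    by (rule card_UN_le[OF finJ])
  also have "\<dots> \<le> card J * s"
    using sum_bounded_above[of J "\<lambda>c. card {l \<in> YR. b l = c}" s] block by simp
  also have "\<dots> \<le> k * s" using J by simp
  finally have Bad: "2 * card Bad \<le> n" using ks by linarith

  have "1 \<le> n" "U \<subseteq> {1..n}" "Bad \<subseteq> {1..n}" using n k by (auto simp: U_def Bad_def)
  from ex_shift_avoiding[OF this Bad] obtain i where
    i: "i \<in> {1..n}" "card U \<le> 2 * card {j \<in> U. cyc n (j + i) \<notin> Bad}" by blast
  \<comment> \<open>For \<open>j \<in> G\<close> all reads of \<open>X j\<close> lie in blocks of
    \<open>J\<close>, and no read of its partner does.\<close>
  define G where "G = {j \<in> U. cyc n (j + i) \<notin> Bad}"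
  have "n \<le> 2 * card G * (4 * k\<^sup>2 + 1) ^ k"
    using nU mult_le_mono1[OF i(2), of "(R + 1) ^ k"]
    unfolding G_def R_def by (rule order.trans)
  moreover have "card (switches (\<lambda>l. b l \<in> J) L) \<le> 2 * k"
    using card_switches_le[OF b_mono finJ, of L] J by linarith
  moreover have "b l \<in> J" if "l \<in> {1..L}" "j \<in> G" "\<rho> l = X j" for l j
    using that by (auto simp: G_def U_def blocks_def)
  moreover have "b l \<notin> J" if "l \<in> {1..L}" "j \<in> G" "\<rho> l = Y (cyc n (j + i))" for l j
    using that cyc_in[OF \<open>1 \<le> n\<close>, of "j + i"] by (auto simp: G_def Bad_def)
  ultimately show ?thesis
    using i(1) \<open>U \<subseteq> {1..n}\<close>
    by (intro exI[of _ G] exI[of _ i] exI[of _ "\<lambda>l. b l \<in> J"]) (auto simp: G_def)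
qed


section \<open>The width bound\<close>

lemma half_le_ln2: "1 / 2 \<le> ln (2::real)"
  by (subst ln_ge_iff) (use exp_half_le2 in simp_all)

text \<open>Taking logarithms gives \<open>n \<le> 8 * k * (4 * k\<^sup>2 + 1) ^ k * ln w\<close>.
  As \<open>K \<ge> 2\<close>, constants are absorbed into powers of \<open>K\<close>: the two
  factors before \<open>ln w\<close> cost \<open>K ^ (4 * k)\<close> and
  \<open>K ^ (5 * k)\<close>.\<close>

lemma width_bound_arith:
  fixes k n g w K :: nat
  assumes k: "1 \<le> k" and n: "n \<le> 2 * g * (4 * k\<^sup>2 + 1) ^ k" and w: "2 ^ g \<le> w ^ (2 * k)"
    and K: "K = max k 2"
  shows "real n / real K ^ (9 * k) \<le> ln (real w)"
proof -
  have w0: "0 < w" using w k by (cases w) (auto simp: power_0_left)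
  have "real g * ln 2 = ln (real (2 ^ g))" by (simp add: ln_realpow)
  also have "\<dots> \<le> ln (real (w ^ (2 * k)))"
    using w w0 by (subst ln_le_cancel_iff) (simp_all del: of_nat_power)
  also have "\<dots> = 2 * real k * ln (real w)" using w0 by (simp add: ln_realpow)
  finally have "real g * ln 2 \<le> 2 * real k * ln (real w)" .
  moreover have "real g * (1/2) \<le> real g * ln 2"
    by (intro mult_left_mono) (use half_le_ln2 in auto)
  ultimately have g: "real g \<le> 4 * real k * ln (real w)" by linarith
  have K2: "2 \<le> K" "k \<le> K" using K by auto
  have "8 * k \<le> K ^ 3 * K" using K2 power_mono[of 2 K 3] by (intro mult_mono) auto
  also have "\<dots> = K ^ 4" by (simp add: numeral_eq_Suc)
  also have "\<dots> \<le> K ^ (4 * k)" using K2 k by (intro power_increasing) auto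
  finally have 1: "8 * k \<le> K ^ (4 * k)" .
  have "4 * k\<^sup>2 + 1 \<le> K ^ 4 + K ^ 4"
    using K2 mult_mono[of 4 "K\<^sup>2" "k\<^sup>2" "K\<^sup>2"] power_mono[of 2 K 2] power_mono[of k K 2]
    by (intro add_mono) (auto simp: power_add[symmetric])
  also have "\<dots> = 2 * K ^ 4" by simp
  also have "\<dots> \<le> K * K ^ 4" using K2(1) by (rule mult_le_mono1)
  also have "\<dots> = K ^ 5" by (simp add: numeral_eq_Suc)
  finally have 2: "(4 * k\<^sup>2 + 1) ^ k \<le> K ^ (5 * k)"
    by (simp add: power_mult power_mono)
  have 3: "8 * k * (4 * k\<^sup>2 + 1) ^ k \<le> K ^ (9 * k)"
    using mult_mono[OF 1 2] by (simp add: power_add[symmetric])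
  have lnw: "0 \<le> ln (real w)" using w0 by simp
  have "real n \<le> 2 * real g * real ((4 * k\<^sup>2 + 1) ^ k)"
    using n by (metis of_nat_le_iff of_nat_mult of_nat_numeral)
  also have "\<dots> \<le> 2 * (4 * real k * ln (real w)) * real ((4 * k\<^sup>2 + 1) ^ k)"
    using g by (intro mult_right_mono mult_left_mono) auto
  also have "\<dots> = real (8 * k * (4 * k\<^sup>2 + 1) ^ k) * ln (real w)" by simp
  also have "\<dots> \<le> real (K ^ (9 * k)) * ln (real w)"
    using 3 lnw by (intro mult_right_mono) (simp_all only: of_nat_le_iff)
  finally show ?thesis
    using K2 by (simp add: divide_le_eq mult.commute)
qed

theorem theorem4p3:
  shows "\<exists>C::real. 0 < C \<and> C \<le> C_max \<and>
           (\<forall>(n::nat) (k::nat) (w::nat) (A :: ('v, qvar, 'a::field) abp).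
              1 \<le> n \<longrightarrow> 1 \<le> k \<longrightarrow>
              read_k_oblivious_abp k A \<longrightarrow> abp_width A = w \<longrightarrow> abp_poly A = Q n \<longrightarrow>
              real w \<ge> exp (real n / k_pow_Ok C k))"
\<comment> \<open>The constant \<open>9\<close> is the exponent factor from
  \<open>width_bound_arith\<close>.\<close>
proof (intro exI[of _ 9] conjI allI impI)
  fix n k w :: nat and A :: "('v, qvar, 'a) abp"
  assume n: "1 \<le> n" and k: "1 \<le> k" and "read_k_oblivious_abp k A"
    and w: "abp_width A = w" and Q: "abp_poly A = Q n"
  then obtain \<rho> where A: "abp A" and \<rho>: "oblivious_reading A \<rho>"
    and reads: "\<And>x. card {l \<in> {1..depth A}. \<rho> l = x} \<le> k"
    unfolding read_k_oblivious_abp_def by blast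
  have width: "abp_width A \<le> w" using w by simp
  define K where "K = max k 2"
  have K: "2 \<le> K" "k \<le> K" by (simp_all add: K_def)
  have "card (layer A 0) \<le> w" "card (layer A 0) = 1"
    using card_layer_le_width[of 0 A] w A by (auto simp: abp_def)
  then have w0: "0 < w" by simp
  have "real n / real K ^ (9 * k) \<le> ln (real w)"
  proof (cases "2 * k \<le> n")
    case True
    from ex_separation[where \<rho> = \<rho>, OF k True reads] obtain G i \<chi> where
      G: "G \<subseteq> {1..n}" "i \<in> {1..n}" and nG: "n \<le> 2 * card G * (4 * k\<^sup>2 + 1) ^ k" and
      sw: "card (switches \<chi> (depth A)) \<le> 2 * k" and
      \<chi>: "\<forall>l\<in>{1..depth A}. \<forall>j\<in>G. (\<rho> l = X j \<longrightarrow> \<chi> l) \<and> (\<rho> l = Y (cyc n (j + i)) \<longrightarrow> \<not> \<chi> l)"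
      by blast
    have "2 ^ card G \<le> w ^ card (switches \<chi> (depth A))"
      using \<chi> by (intro two_power_le_width_power[OF A width \<rho> Q G]) auto
    also have "\<dots> \<le> w ^ (2 * k)"
      using w0 sw by (intro power_increasing) auto
    finally show ?thesis
      by (intro width_bound_arith[OF k nG _ K_def])
  next
    case False
    \<comment> \<open>For \<open>n < 2 * k\<close> the exponent is at most \<open>1 / 2\<close>, so
      \<open>w \<ge> 2\<close> suffices. The singleton \<open>{1}\<close> with shift
      \<open>1\<close> rules out \<open>w = 1\<close>.\<close>
    have "2 ^ card {1::nat} \<le> w ^ card (switches (\<lambda>l. \<rho> l = X 1) (depth A))"
      using n by (intro two_power_le_width_power[OF A width \<rho> Q, of "{1}" 1]) auto
    then have "w \<noteq> 1" by auto
    with w0 have "2 \<le> w" by simp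
    have "2 * n \<le> K ^ 3"
    proof -
      have "n \<le> K * K" using False K mult_mono[of 2 K k K] by simp
      then have "2 * n \<le> K * (K * K)" using K by (intro mult_mono) auto
      then show ?thesis by (simp add: numeral_eq_Suc)
    qed
    also have "\<dots> \<le> K ^ (9 * k)"
      using K k by (intro power_increasing) auto
    finally have "real (2 * n) \<le> real (K ^ (9 * k))" by (simp only: of_nat_le_iff)
    then have "real n / real K ^ (9 * k) \<le> 1 / 2"
      using K by (simp add: divide_le_eq)
    also have "\<dots> \<le> ln 2" using half_le_ln2 by simp
    also have "\<dots> \<le> ln (real w)" using \<open>2 \<le> w\<close> by simp
    finally show ?thesis .
  qed
  moreover have "k_pow_Ok 9 k = real K ^ (9 * k)"
    using K by (simp add: k_pow_Ok_def K_def powr_realpow[symmetric])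
  ultimately have "exp (real n / k_pow_Ok 9 k) \<le> exp (ln (real w))" by simp
  then show "exp (real n / k_pow_Ok 9 k) \<le> real w" using w0 by simp
qed (simp_all add: C_max_def)

end
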